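(* Fix $k \geq 2$. Let $G_O=(V_O,E_O)$ be a graph, let $G_N=(V_N,E_N)$ be obtained by inserting a graph $G_A=(V_A,E_A)$ into $G_O$, with a positive vertex weight function $w$ on $V_N$, and let $OPT(G_O)$ be a minimum-weight $k$-path vertex cover of $G_O$. Let $A_\rho$ be a $\rho$-approximation algorithm ($\rho \geq 1$) for weighted $k$-path vertex cover, and let $T(A_\rho, G_N)$ denote its running time on $G_N$. Let $\mathscr{F} = \{F_1,\dots,F_\psi\}$ be a good family of subsets of $V_N$. Consider the algorithm Construct-Sol which, for each $i=1,\dots,\psi$, sets $S^1_i = OPT(G_O)\cup F_i$, runs $A_\rho$ on $G' = G_N[(V_N - V_A) - F_i]$ to obtain a set $S'$ and sets $S^2_i = S' \cup F_i$, lets $S_i$ be the one of $S^1_i, S^2_i$ of smaller weight, and finally outputs $ALG(G_N)$, the minimum-weight set among $S_1,\dots,S_\psi$. Then $ALG(G_N)$ is a $k$-path vertex cover of $G_N$ with $w(ALG(G_N)) \leq (2-\frac{1}{\rho})\, w(OPT(G_N))$, where $OPT(G_N)$ is a minimum-weight $k$-path vertex cover of $G_N$, and the algorithm runs in $O(|V(G_N)|^2 \cdot \psi \cdot T(A_\rho, G_N))$ steps.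
   Context: All graphs are finite, simple and undirected. A $k$-path is a simple path containing exactly $k$ vertices; $S \subseteq V(G)$ is a $k$-path vertex cover of $G$ if every $k$-path of $G$ contains a vertex of $S$. For $U\subseteq V$, $w(U)=\sum_{v\in U}w(v)$ and $G[U]$ is the induced subgraph. Inserting a graph $G_A=(V_A,E_A)$ (disjoint from $G_O$) into $G_O=(V_O,E_O)$ via attachment edges $E^a\subseteq V_O\times V_A$ yields $G_N=(V_O\cup V_A, E_O\cup E_A\cup E^a)$. A family $\mathscr{F}=\{F_1,\dots,F_\psi\}$ of subsets of $V_N$ is called good if (1) there exists $F_i \in \mathscr{F}$ with $F_i \subseteq OPT(G_N)$, and (2) every $F_i\in\mathscr{F}$ covers (i.e., meets) every $k$-path of $G_N$ that contains at least one vertex of $V_A$. A $\rho$-approximation algorithm for weighted $k$-path vertex cover outputs, on any vertex-weighted graph, a $k$-path vertex cover of weight at most $\rho$ times the minimum.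
   Formalization: The running time T(A_ρ, ·) is taken to be any bound on the steps of A_ρ that is at least 1 and does not increase on passing to induced subgraphs (the time claim fails if A_ρ is fast on G_N but slow on G'); the time bound is stated for nonempty V_N. *)

theory Defs
  imports Complex_Main "HOL-Library.Monad_Syntax"
begin

section \<open>Finite simple undirected graphs\<close>

type_synonym 'a ugraph = "'a set \<times> 'a set set"

abbreviation verts :: "'a ugraph \<Rightarrow> 'a set" where "verts \<equiv> fst"
abbreviation edges :: "'a ugraph \<Rightarrow> 'a set set" where "edges \<equiv> snd"

definition simple_graph :: "'a ugraph \<Rightarrow> bool" where
  "simple_graph G \<longleftrightarrow> finite (verts G) \<and>
     edges G \<subseteq> {{u, v} | u v. u \<in> verts G \<and> v \<in> verts G \<and> u \<noteq> v}"

definition induced :: "'a ugraph \<Rightarrow> 'a set \<Rightarrow> 'a ugraph" where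
  "induced G U = (U, {e \<in> edges G. e \<subseteq> U})"

definition insert_graph :: "'a ugraph \<Rightarrow> 'a ugraph \<Rightarrow> ('a \<times> 'a) set \<Rightarrow> 'a ugraph" where
  "insert_graph G\<^sub>O G\<^sub>A Ea =
     (verts G\<^sub>O \<union> verts G\<^sub>A, edges G\<^sub>O \<union> edges G\<^sub>A \<union> {{u, v} | u v. (u, v) \<in> Ea})"

section \<open>Weighted k-path vertex cover\<close>

definition kpath :: "nat \<Rightarrow> 'a ugraph \<Rightarrow> 'a list \<Rightarrow> bool" where
  "kpath k G p \<longleftrightarrow> length p = k \<and> distinct p \<and> set p \<subseteq> verts G \<and>
     (\<forall>i. Suc i < k \<longrightarrow> {p ! i, p ! Suc i} \<in> edges G)"

definition kpvc :: "nat \<Rightarrow> 'a ugraph \<Rightarrow> 'a set \<Rightarrow> bool" where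
  "kpvc k G S \<longleftrightarrow> S \<subseteq> verts G \<and> (\<forall>p. kpath k G p \<longrightarrow> set p \<inter> S \<noteq> {})"

definition weight :: "('a \<Rightarrow> real) \<Rightarrow> 'a set \<Rightarrow> real" where
  "weight w U = (\<Sum>v\<in>U. w v)"

definition min_kpvc :: "nat \<Rightarrow> 'a ugraph \<Rightarrow> ('a \<Rightarrow> real) \<Rightarrow> 'a set \<Rightarrow> bool" where
  "min_kpvc k G w S \<longleftrightarrow> kpvc k G S \<and> (\<forall>S'. kpvc k G S' \<longrightarrow> weight w S \<le> weight w S')"

definition pos_weight :: "'a ugraph \<Rightarrow> ('a \<Rightarrow> real) \<Rightarrow> bool" where
  "pos_weight G w \<longleftrightarrow> (\<forall>v\<in>verts G. 0 < w v)"

text \<open>The minimum-weight cover \<open>OPT\<close> of \<open>G\<^sub>N\<close> and the inserted vertex set \<open>V\<^sub>A\<close> are parameters.\<close>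

definition good_family ::
  "nat \<Rightarrow> 'a ugraph \<Rightarrow> 'a set \<Rightarrow> 'a set \<Rightarrow> 'a set set \<Rightarrow> bool" where
  "good_family k G\<^sub>N V\<^sub>A OPT \<F> \<longleftrightarrow>
     (\<forall>F\<in>\<F>. F \<subseteq> verts G\<^sub>N) \<and>
     (\<exists>F\<in>\<F>. F \<subseteq> OPT) \<and>
     (\<forall>F\<in>\<F>. \<forall>p. kpath k G\<^sub>N p \<and> set p \<inter> V\<^sub>A \<noteq> {} \<longrightarrow> set p \<inter> F \<noteq> {})"

section \<open>Step-counting computations\<close>

datatype 'r timed = Timed (result: 'r) (steps: nat)

definition ret :: "'r \<Rightarrow> 'r timed" where
  "ret x = Timed x 0"

definition bind_timed :: "'r timed \<Rightarrow> ('r \<Rightarrow> 's timed) \<Rightarrow> 's timed" where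
  "bind_timed m f = Timed (result (f (result m))) (steps m + steps (f (result m)))"

adhoc_overloading Monad_Syntax.bind \<rightleftharpoons> bind_timed

text \<open>
  The machine model is a random access machine with unit-cost arithmetic on weights. A vertex set
  is a Boolean array indexed by the vertices of \<open>G\<^sub>N\<close>, an edge set is an adjacency matrix; reading
  or writing one entry is one step, and allocating a cleared array costs its number of entries.
\<close>

definition elem_op :: "'r \<Rightarrow> 'r timed" where
  "elem_op x = Timed x 1"

definition new_array :: "nat \<Rightarrow> 'b set timed" where
  "new_array m = Timed {} m"

fun for_each :: "'b list \<Rightarrow> ('b \<Rightarrow> 's \<Rightarrow> 's timed) \<Rightarrow> 's \<Rightarrow> 's timed" where
  "for_each [] body s = ret s"
| "for_each (x # xs) body s =
     do { x \<leftarrow> elem_op x; s' \<leftarrow> body x s; for_each xs body s' }"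

section \<open>Approximation algorithms\<close>

type_synonym 'a cover_alg = "'a ugraph \<Rightarrow> ('a \<Rightarrow> real) \<Rightarrow> 'a set timed"

definition approx_alg :: "nat \<Rightarrow> real \<Rightarrow> 'a cover_alg \<Rightarrow> bool" where
  "approx_alg k \<rho> A \<longleftrightarrow> (\<forall>G w. simple_graph G \<and> pos_weight G w \<longrightarrow>
     kpvc k G (result (A G w)) \<and>
     (\<forall>S. min_kpvc k G w S \<longrightarrow> weight w (result (A G w)) \<le> \<rho> * weight w S))"

text \<open>
  \<open>T\<close> is a running time for \<open>A\<close>: it bounds the number of steps on every weighted graph, is at
  least one, and does not increase when passing to an induced subgraph. The last condition is what
  allows the time spent on a subinstance of \<open>G\<^sub>N\<close> to be charged to \<open>T G\<^sub>N\<close>; \<open>A\<close> itself is not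
  restricted by it, since the maximum of one and the number of steps over all induced subgraphs is
  always such a \<open>T\<close>.
\<close>

definition running_time :: "'a cover_alg \<Rightarrow> ('a ugraph \<Rightarrow> ('a \<Rightarrow> real) \<Rightarrow> nat) \<Rightarrow> bool" where
  "running_time A T \<longleftrightarrow> (\<forall>G w. simple_graph G \<and> pos_weight G w \<longrightarrow>
     steps (A G w) \<le> T G w \<and> 1 \<le> T G w \<and>
     (\<forall>U\<subseteq>verts G. T (induced G U) w \<le> T G w))"

section \<open>The algorithm Construct-Sol\<close>

text \<open>In the following, \<open>vs\<close> enumerates the vertices of \<open>G\<^sub>N\<close>.\<close>

definition union_op :: "'a list \<Rightarrow> 'a set \<Rightarrow> 'a set \<Rightarrow> 'a set timed" where
  "union_op vs X Y = do {
     Z \<leftarrow> new_array (length vs);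
     for_each vs (\<lambda>v Z. do {
       x \<leftarrow> elem_op (v \<in> X);
       y \<leftarrow> elem_op (v \<in> Y);
       if x \<or> y then elem_op (insert v Z) else ret Z }) Z }"

definition rest_op :: "'a list \<Rightarrow> 'a set \<Rightarrow> 'a set \<Rightarrow> 'a set timed" where
  "rest_op vs X Y = do {
     Z \<leftarrow> new_array (length vs);
     for_each vs (\<lambda>v Z. do {
       x \<leftarrow> elem_op (v \<in> X);
       y \<leftarrow> elem_op (v \<in> Y);
       if \<not> x \<and> \<not> y then elem_op (insert v Z) else ret Z }) Z }"

definition induced_op :: "'a list \<Rightarrow> 'a set set \<Rightarrow> 'a set \<Rightarrow> 'a ugraph timed" where
  "induced_op vs E U = do {
     E' \<leftarrow> new_array (length vs * length vs);
     E' \<leftarrow> for_each vs (\<lambda>u. for_each vs (\<lambda>v E'. do {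
       a \<leftarrow> elem_op (u \<in> U);
       b \<leftarrow> elem_op (v \<in> U);
       e \<leftarrow> elem_op ({u, v} \<in> E);
       if a \<and> b \<and> e then elem_op (insert {u, v} E') else ret E' })) E';
     ret (U, E') }"

definition weight_op :: "'a list \<Rightarrow> ('a \<Rightarrow> real) \<Rightarrow> 'a set \<Rightarrow> real timed" where
  "weight_op vs w X =
     for_each vs (\<lambda>v r. do {
       x \<leftarrow> elem_op (v \<in> X);
       if x then do { c \<leftarrow> elem_op (w v); elem_op (r + c) } else ret r }) 0"

definition lighter_op :: "'a set \<times> real \<Rightarrow> 'a set \<times> real \<Rightarrow> ('a set \<times> real) timed" where
  "lighter_op P Q = do {
     le \<leftarrow> elem_op (snd P \<le> snd Q);
     ret (if le then P else Q) }"

definition candidate ::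
  "'a cover_alg \<Rightarrow> 'a list \<Rightarrow> 'a set set \<Rightarrow> 'a set \<Rightarrow> ('a \<Rightarrow> real) \<Rightarrow> 'a set \<Rightarrow> 'a set
     \<Rightarrow> ('a set \<times> real) timed" where
  "candidate A vs E\<^sub>N V\<^sub>A w OPT\<^sub>O F = do {
     S1 \<leftarrow> union_op vs OPT\<^sub>O F;
     U \<leftarrow> rest_op vs V\<^sub>A F;
     G' \<leftarrow> induced_op vs E\<^sub>N U;
     S' \<leftarrow> A G' w;
     S2 \<leftarrow> union_op vs S' F;
     w1 \<leftarrow> weight_op vs w S1;
     w2 \<leftarrow> weight_op vs w S2;
     lighter_op (S1, w1) (S2, w2) }"

text \<open>The value on an empty family is irrelevant, since good families are nonempty.\<close>

fun construct_sol ::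
  "'a cover_alg \<Rightarrow> 'a list \<Rightarrow> 'a set set \<Rightarrow> 'a set \<Rightarrow> ('a \<Rightarrow> real) \<Rightarrow> 'a set \<Rightarrow> 'a set list
     \<Rightarrow> 'a set timed" where
  "construct_sol A vs E\<^sub>N V\<^sub>A w OPT\<^sub>O [] = ret {}"
| "construct_sol A vs E\<^sub>N V\<^sub>A w OPT\<^sub>O (F # Fs) = do {
     P \<leftarrow> candidate A vs E\<^sub>N V\<^sub>A w OPT\<^sub>O F;
     Q \<leftarrow> for_each Fs (\<lambda>F' best. do {
       P' \<leftarrow> candidate A vs E\<^sub>N V\<^sub>A w OPT\<^sub>O F';
       lighter_op best P' }) P;
     ret (fst Q) }"

section \<open>What the elementary routines compute\<close>

lemma timed_simps [simp]:
  "result (ret x) = x" "steps (ret x) = 0"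
  "result (elem_op x) = x" "steps (elem_op x) = 1"
  "result (new_array n) = {}" "steps (new_array n) = n"
  "result (bind_timed m f) = result (f (result m))"
  "steps (bind_timed m f) = steps m + steps (f (result m))"
  by (simp_all add: ret_def elem_op_def new_array_def bind_timed_def)

lemma result_for_each:
  "result (for_each xs body s) = fold (\<lambda>x s. result (body x s)) xs s"
  by (induction xs arbitrary: s) simp_all

lemma result_if: "result (if b then x else y) = (if b then result x else result y)"
  by simp

lemma fold_collect: "fold (\<lambda>v Z. if P v then insert (f v) Z else Z) xs Z = Z \<union> f ` {v \<in> set xs. P v}"
  by (induction xs arbitrary: Z) auto

lemma fold_Un: "fold (\<lambda>v Z. Z \<union> f v) xs Z = Z \<union> (\<Union>v\<in>set xs. f v)"
  by (induction xs arbitrary: Z) auto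

lemma result_union_op: "result (union_op vs X Y) = (X \<union> Y) \<inter> set vs"
  by (auto simp: union_op_def result_for_each result_if fold_collect[where f = "\<lambda>v. v"] cong: if_cong)

lemma result_rest_op: "result (rest_op vs X Y) = (set vs - X) - Y"
  by (auto simp: rest_op_def result_for_each result_if fold_collect[where f = "\<lambda>v. v"] cong: if_cong)

lemma result_induced_op:
  assumes "simple_graph G" "set vs = verts G" "U \<subseteq> verts G"
  shows "result (induced_op vs (edges G) U) = induced G U"
proof -
  have "result (induced_op vs (edges G) U) =
      (U, \<Union>u\<in>set vs. (\<lambda>v. {u, v}) ` {v \<in> set vs. u \<in> U \<and> v \<in> U \<and> {u, v} \<in> edges G})"
    by (simp add: induced_op_def result_for_each result_if fold_collect fold_Un cong: if_cong)
  also have "\<dots> = induced G U"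
    using assms unfolding induced_def simple_graph_def by fastforce
  finally show ?thesis .
qed

lemma result_weight_op:
  assumes "distinct vs" "X \<subseteq> set vs"
  shows "result (weight_op vs w X) = weight w X"
proof -
  have *: "fold (\<lambda>v r. if v \<in> X then r + w v else r) vs r = r + (\<Sum>v\<in>set vs \<inter> X. w v)" for r
    using assms(1) by (induction vs arbitrary: r) auto
  have "set vs \<inter> X = X" using assms(2) by blast
  then show ?thesis
    using *[of 0] by (simp add: weight_op_def weight_def result_for_each result_if cong: if_cong)
qed

end

theory Submission
  imports Defs
begin

text \<open>
  Let \<open>F \<subseteq> OPT(G\<^sub>N)\<close> be a member of the family, \<open>o = w(OPT(G\<^sub>N))\<close> and \<open>f = w(F)\<close>. Since
  \<open>OPT(G\<^sub>N) \<inter> V\<^sub>O\<close> covers \<open>G\<^sub>O\<close>, the first candidate weighs at most \<open>o + f\<close>; since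
  \<open>OPT(G\<^sub>N) - F\<close> covers what remains, the second weighs at most \<open>\<rho> (o - f) + f\<close>. The convex
  combination of these bounds with coefficients \<open>1 - 1/\<rho>\<close> and \<open>1/\<rho>\<close> is free of \<open>f\<close> and
  equals \<open>(2 - 1/\<rho>) o\<close>.
\<close>

section \<open>Simplicity of induced subgraphs and of insertions\<close>

lemma simple_graph_induced:
  assumes "simple_graph G" "U \<subseteq> verts G"
  shows "simple_graph (induced G U)"
proof -
  have "finite U"
    using assms finite_subset unfolding simple_graph_def by blast
  moreover have "e \<in> {{u, v} | u v. u \<in> U \<and> v \<in> U \<and> u \<noteq> v}" if e: "e \<in> edges G" "e \<subseteq> U" for e
  proof -
    obtain u v where "e = {u, v}" "u \<noteq> v"
      using e(1) assms(1) unfolding simple_graph_def by blast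
    then show ?thesis
      using e(2) by blast
  qed
  ultimately show ?thesis
    unfolding simple_graph_def induced_def by (simp add: subset_eq)
qed

lemma simple_graph_insert_graph:
  assumes "simple_graph G\<^sub>O" "simple_graph G\<^sub>A" "verts G\<^sub>O \<inter> verts G\<^sub>A = {}"
    "Ea \<subseteq> verts G\<^sub>O \<times> verts G\<^sub>A"
  shows "simple_graph (insert_graph G\<^sub>O G\<^sub>A Ea)"
proof -
  let ?P = "\<lambda>V. {{u, v} | u v. u \<in> V \<and> v \<in> V \<and> u \<noteq> v}"
  have "?P (verts G\<^sub>O) \<subseteq> ?P (verts G\<^sub>O \<union> verts G\<^sub>A)" "?P (verts G\<^sub>A) \<subseteq> ?P (verts G\<^sub>O \<union> verts G\<^sub>A)"
    by blast+
  moreover have "edges G\<^sub>O \<subseteq> ?P (verts G\<^sub>O)" "edges G\<^sub>A \<subseteq> ?P (verts G\<^sub>A)"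
    using assms(1,2) unfolding simple_graph_def by blast+
  \<comment> \<open>The ends of an attachment edge lie in disjoint vertex sets, hence are distinct:
    no loop arises.\<close>
  moreover have "{{u, v} | u v. (u, v) \<in> Ea} \<subseteq> ?P (verts G\<^sub>O \<union> verts G\<^sub>A)"
    using assms(3,4) by fastforce
  ultimately have "edges G\<^sub>O \<union> edges G\<^sub>A \<union> {{u, v} | u v. (u, v) \<in> Ea}
      \<subseteq> ?P (verts G\<^sub>O \<union> verts G\<^sub>A)"
    by (meson Un_least order_trans)
  then show ?thesis
    using assms(1,2) unfolding simple_graph_def insert_graph_def by simp
qed

section \<open>Paths and covers in induced subgraphs\<close>

lemma kpath_induced:
  assumes "kpath k G p" "set p \<subseteq> U"
  shows "kpath k (induced G U) p"
  using assms unfolding kpath_def induced_def by (auto simp: subset_iff)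

lemma kpath_of_induced:
  assumes "kpath k (induced G U) p" "U \<subseteq> verts G"
  shows "kpath k G p"
  using assms unfolding kpath_def induced_def by auto

text \<open>Every inserted or attachment edge has an end in \<open>verts G\<^sub>A\<close>, so none
  survives the restriction. This makes a cover of \<open>G\<^sub>O\<close> a cover of an induced
  subgraph of the new graph, which the next two lemmas require.\<close>

lemma induced_insert_graph:
  assumes "simple_graph G\<^sub>O" "simple_graph G\<^sub>A" "verts G\<^sub>O \<inter> verts G\<^sub>A = {}"
    "Ea \<subseteq> verts G\<^sub>O \<times> verts G\<^sub>A"
  shows "induced (insert_graph G\<^sub>O G\<^sub>A Ea) (verts G\<^sub>O) = G\<^sub>O"
proof -
  have "e \<subseteq> verts G\<^sub>O" if "e \<in> edges G\<^sub>O" for e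
    using that assms(1) unfolding simple_graph_def by blast
  moreover have "\<not> e \<subseteq> verts G\<^sub>O" if "e \<in> edges G\<^sub>A" for e
    using that assms(2,3) unfolding simple_graph_def by blast
  moreover have "\<not> {u, v} \<subseteq> verts G\<^sub>O" if "(u, v) \<in> Ea" for u v
    using that assms(3,4) by blast
  ultimately have "{e \<in> edges (insert_graph G\<^sub>O G\<^sub>A Ea). e \<subseteq> verts G\<^sub>O} = edges G\<^sub>O"
    unfolding insert_graph_def by auto
  then show ?thesis
    by (simp add: induced_def)
qed

text \<open>A path of the subgraph is a path of \<open>G\<close> lying inside \<open>U\<close>, so
  \<open>S\<close> meets it within \<open>U\<close>. It turns a cover of the new graph into
  competitors for \<open>OPT\<^sub>O\<close> and for the output of \<open>A\<close>.\<close>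

lemma kpvc_induced:
  assumes "kpvc k G S" "U \<subseteq> verts G"
  shows "kpvc k (induced G U) (S \<inter> U)"
proof -
  have "set p \<inter> (S \<inter> U) \<noteq> {}" if p: "kpath k (induced G U) p" for p
  proof -
    have "set p \<inter> S \<noteq> {}"
      using assms kpath_of_induced[OF p] unfolding kpvc_def by blast
    moreover have "set p \<subseteq> U"
      using p unfolding kpath_def induced_def by simp
    ultimately show ?thesis by blast
  qed
  then show ?thesis
    unfolding kpvc_def by (simp add: induced_def)
qed

text \<open>Paths inside \<open>U\<close> are met by \<open>S\<close>, all others by
  \<open>F\<close>. Both candidate covers are instances: \<open>U\<close> is the old vertex set for
  the first, and the old vertex set without \<open>F\<close> for the second.\<close>

lemma kpvc_extend:
  assumes "kpvc k (induced G U) S" "U \<subseteq> verts G" "F \<subseteq> verts G"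
    and "\<And>p. kpath k G p \<Longrightarrow> \<not> set p \<subseteq> U \<Longrightarrow> set p \<inter> F \<noteq> {}"
  shows "kpvc k G (S \<union> F)"
proof -
  have "set p \<inter> (S \<union> F) \<noteq> {}" if p: "kpath k G p" for p
  proof (cases "set p \<subseteq> U")
    case True
    then show ?thesis
      using assms(1) kpath_induced[OF p] unfolding kpvc_def by blast
  next
    case False
    then show ?thesis
      using assms(4)[OF p] by blast
  qed
  moreover have "S \<subseteq> U"
    using assms(1) unfolding kpvc_def induced_def by simp
  ultimately show ?thesis
    using assms(2,3) unfolding kpvc_def by blast
qed

lemma min_kpvc_exists:
  assumes "simple_graph G" "kpvc k G S\<^sub>0"
  obtains S where "min_kpvc k G w S"
proof -
  have "{S. kpvc k G S} \<subseteq> Pow (verts G)"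
    unfolding kpvc_def by blast
  then have fin: "finite {S. kpvc k G S}"
    using assms(1) finite_subset unfolding simple_graph_def by blast
  define S where "S = arg_min_on (weight w) {S. kpvc k G S}"
  have "S \<in> {S. kpvc k G S}"
    unfolding S_def using fin assms(2) by (intro arg_min_if_finite) auto
  moreover have "weight w S \<le> weight w S'" if "kpvc k G S'" for S'
    unfolding S_def using fin that by (intro arg_min_least) auto
  ultimately show ?thesis
    using that unfolding min_kpvc_def by blast
qed

text \<open>The guarantee of \<open>approx_alg\<close> speaks of minimum covers only. As a minimum
  cover exists once there is any cover, the guarantee carries over to an arbitrary
  \<open>S\<close>.\<close>

lemma approx_alg_le:
  assumes "approx_alg k \<rho> A" "0 \<le> \<rho>" "simple_graph G" "pos_weight G w" "kpvc k G S"
  shows "weight w (result (A G w)) \<le> \<rho> * weight w S"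
proof -
  obtain S\<^sub>0 where S\<^sub>0: "min_kpvc k G w S\<^sub>0"
    using min_kpvc_exists[OF assms(3,5)] .
  then have "weight w (result (A G w)) \<le> \<rho> * weight w S\<^sub>0"
    using assms(1,3,4) unfolding approx_alg_def by blast
  also have "\<dots> \<le> \<rho> * weight w S"
    using S\<^sub>0 assms(2,5) unfolding min_kpvc_def by (intro mult_left_mono) blast+
  finally show ?thesis .
qed

section \<open>Monotonicity and subadditivity of weights\<close>

lemma weight_mono:
  assumes "finite B" "A \<subseteq> B" "\<And>v. v \<in> B \<Longrightarrow> 0 \<le> w v"
  shows "weight w A \<le> weight w B"
  unfolding weight_def using assms by (intro sum_mono2) auto

lemma weight_Un_le:
  assumes "finite A" "finite B" "\<And>v. v \<in> A \<union> B \<Longrightarrow> 0 \<le> w v"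
  shows "weight w (A \<union> B) \<le> weight w A + weight w B"
proof -
  have "weight w (A \<union> B) + weight w (A \<inter> B) = weight w A + weight w B"
    unfolding weight_def using sum.union_inter[OF assms(1,2)] .
  moreover have "0 \<le> weight w (A \<inter> B)"
    unfolding weight_def using assms(3) by (intro sum_nonneg) auto
  ultimately show ?thesis by linarith
qed

section \<open>Step counts of the elementary routines\<close>

lemma steps_for_each_le:
  assumes "\<And>x s. x \<in> set xs \<Longrightarrow> steps (body x s) \<le> c"
  shows "steps (for_each xs body s) \<le> length xs * (c + 1)"
  using assms
proof (induction xs arbitrary: s)
  case (Cons x xs)
  have "steps (body x s) \<le> c"
    using Cons.prems by simp
  moreover have "steps (for_each xs body (result (body x s))) \<le> length xs * (c + 1)"
    using Cons.prems by (intro Cons.IH) simp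
  \<comment> \<open>The 1 in \<open>c + 1\<close> pays for fetching the list element.\<close>
  ultimately show ?case by simp
qed simp

text \<open>Per vertex: one fetch, two reads and at most one write; the fifth step is its share of
  the allocation.\<close>

lemma steps_union_op: "steps (union_op vs X Y) \<le> 5 * length vs"
proof -
  have "steps (for_each vs (\<lambda>v Z. do {
       x \<leftarrow> elem_op (v \<in> X);
       y \<leftarrow> elem_op (v \<in> Y);
       if x \<or> y then elem_op (insert v Z) else ret Z }) {}) \<le> length vs * (3 + 1)"
    by (rule steps_for_each_le) simp
  then show ?thesis by (simp add: union_op_def)
qed

lemma steps_rest_op: "steps (rest_op vs X Y) \<le> 5 * length vs"
proof -
  have "steps (for_each vs (\<lambda>v Z. do {
       x \<leftarrow> elem_op (v \<in> X);
       y \<leftarrow> elem_op (v \<in> Y);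
       if \<not> x \<and> \<not> y then elem_op (insert v Z) else ret Z }) {}) \<le> length vs * (3 + 1)"
    by (rule steps_for_each_le) simp
  then show ?thesis by (simp add: rest_op_def)
qed

text \<open>Each pair of vertices costs a fetch, three reads, at most one write and one matrix cell
  to allocate, which gives 6; the linear term counts the fetches of the outer loop.\<close>

lemma steps_induced_op: "steps (induced_op vs E U) \<le> 6 * (length vs)\<^sup>2 + length vs"
proof -
  have "steps (for_each vs (\<lambda>u. for_each vs (\<lambda>v E'. do {
       a \<leftarrow> elem_op (u \<in> U);
       b \<leftarrow> elem_op (v \<in> U);
       e \<leftarrow> elem_op ({u, v} \<in> E);
       if a \<and> b \<and> e then elem_op (insert {u, v} E') else ret E' })) {})
     \<le> length vs * (length vs * (4 + 1) + 1)"
    by (intro steps_for_each_le) simp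
  then show ?thesis
    by (simp add: induced_op_def power2_eq_square algebra_simps)
qed

lemma steps_weight_op: "steps (weight_op vs w X) \<le> 4 * length vs"
proof -
  have "steps (weight_op vs w X) \<le> length vs * (3 + 1)"
    unfolding weight_op_def by (rule steps_for_each_le) simp
  then show ?thesis by simp
qed

section \<open>Selection of the lightest candidate\<close>

lemma result_lighter_op: "result (lighter_op P Q) = (if snd P \<le> snd Q then P else Q)"
  by (simp add: lighter_op_def)

lemma steps_lighter_op: "steps (lighter_op P Q) = 1"
  by (simp add: lighter_op_def)

text \<open>The accumulator \<open>P\<close> counts as an entry and is left arbitrary in the
  induction, since each step replaces it by the lighter of itself and the next candidate.\<close>

lemma fold_lighter:
  fixes c :: "'b \<Rightarrow> 's \<times> real"
  defines "r \<equiv> \<lambda>xs P. fold (\<lambda>x best. if snd best \<le> snd (c x) then best else c x) xs P"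
  shows "r xs P \<in> insert P (c ` set xs) \<and> (\<forall>Q \<in> insert P (c ` set xs). snd (r xs P) \<le> snd Q)"
proof (induction xs arbitrary: P)
  case Nil
  then show ?case by (simp add: r_def)
next
  case (Cons x xs)
  let ?P = "if snd P \<le> snd (c x) then P else c x"
  have "r (x # xs) P = r xs ?P" by (simp add: r_def)
  then show ?case
    using Cons.IH[of ?P] by (auto split: if_splits)
qed

lemma result_construct_sol:
  fixes A :: "'a cover_alg" and vs :: "'a list" and E\<^sub>N :: "'a set set" and V\<^sub>A OPT\<^sub>O :: "'a set"
    and w :: "'a \<Rightarrow> real"
  assumes "Fs \<noteq> []"
  defines "c \<equiv> \<lambda>F. result (candidate A vs E\<^sub>N V\<^sub>A w OPT\<^sub>O F)"
  obtains F where "F \<in> set Fs"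
    "result (construct_sol A vs E\<^sub>N V\<^sub>A w OPT\<^sub>O Fs) = fst (c F)"
    "\<And>F'. F' \<in> set Fs \<Longrightarrow> snd (c F) \<le> snd (c F')"
proof -
  obtain F\<^sub>0 Fs' where Fs: "Fs = F\<^sub>0 # Fs'"
    using assms(1) by (cases Fs) auto
  define Q where
    "Q = fold (\<lambda>F best. if snd best \<le> snd (c F) then best else c F) Fs' (c F\<^sub>0)"
  have res: "result (construct_sol A vs E\<^sub>N V\<^sub>A w OPT\<^sub>O Fs) = fst Q"
    by (simp add: Fs Q_def c_def result_for_each result_lighter_op cong: if_cong)
  have "Q \<in> c ` set Fs" "\<forall>F' \<in> set Fs. snd Q \<le> snd (c F')"
    using fold_lighter[of c Fs' "c F\<^sub>0"] by (simp_all add: Fs Q_def)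
  then show ?thesis
    using that res by blast
qed

text \<open>Beyond its candidate, each member after the first costs a fetch and a comparison, hence
  \<open>c + 2\<close>.\<close>

lemma steps_construct_sol_le:
  assumes "\<And>F. F \<in> set Fs \<Longrightarrow> steps (candidate A vs E\<^sub>N V\<^sub>A w OPT\<^sub>O F) \<le> c"
  shows "steps (construct_sol A vs E\<^sub>N V\<^sub>A w OPT\<^sub>O Fs) \<le> length Fs * (c + 2)"
proof (cases Fs)
  case (Cons F Fs')
  have "steps (for_each Fs' (\<lambda>F' best. do {
       P' \<leftarrow> candidate A vs E\<^sub>N V\<^sub>A w OPT\<^sub>O F';
       lighter_op best P' }) (result (candidate A vs E\<^sub>N V\<^sub>A w OPT\<^sub>O F))) \<le> length Fs' * (c + 1 + 1)"
    using assms Cons by (intro steps_for_each_le) (simp add: steps_lighter_op)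
  moreover have "steps (candidate A vs E\<^sub>N V\<^sub>A w OPT\<^sub>O F) \<le> c"
    using assms Cons by simp
  ultimately show ?thesis
    using Cons by simp
qed simp

lemma min_le_convex_combination:
  fixes a b f opt \<rho> :: real
  assumes "1 \<le> \<rho>" "a \<le> opt + f" "b \<le> \<rho> * (opt - f) + f"
  shows "min a b \<le> (2 - 1 / \<rho>) * opt"
proof -
  have "\<rho> * min a b = (\<rho> - 1) * min a b + min a b"
    by (simp add: algebra_simps)
  \<comment> \<open>The convex combination scaled by \<open>\<rho>\<close>: the coefficients
    \<open>\<rho> - 1\<close> and 1 are nonnegative, and the terms in \<open>f\<close> cancel in the
    next step.\<close>
  also have "\<dots> \<le> (\<rho> - 1) * (opt + f) + (\<rho> * (opt - f) + f)"
    using assms by (intro add_mono mult_left_mono) auto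
  also have "\<dots> = \<rho> * ((2 - 1 / \<rho>) * opt)"
    using assms(1) by (simp add: field_simps)
  finally show ?thesis
    using assms(1) by simp
qed

section \<open>The two candidate covers of a fixed insertion instance\<close>

locale inserted_graph =
  fixes k :: nat and \<rho> :: real and A :: "'a cover_alg"
    and G\<^sub>O G\<^sub>A G\<^sub>N :: "'a ugraph" and Ea :: "('a \<times> 'a) set" and w :: "'a \<Rightarrow> real"
    and OPT\<^sub>O :: "'a set" and vs :: "'a list"
  assumes simple_O: "simple_graph G\<^sub>O" and simple_A: "simple_graph G\<^sub>A"
    and disjoint: "verts G\<^sub>O \<inter> verts G\<^sub>A = {}" and Ea: "Ea \<subseteq> verts G\<^sub>O \<times> verts G\<^sub>A"
    and G\<^sub>N: "G\<^sub>N = insert_graph G\<^sub>O G\<^sub>A Ea"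
    and pos: "pos_weight G\<^sub>N w"
    and OPT\<^sub>O: "min_kpvc k G\<^sub>O w OPT\<^sub>O"
    and \<rho>: "1 \<le> \<rho>" and approx: "approx_alg k \<rho> A"
    and distinct: "distinct vs" and set_vs: "set vs = verts G\<^sub>N"
begin

abbreviation rest :: "'a set \<Rightarrow> 'a set" where
  "rest F \<equiv> verts G\<^sub>N - verts G\<^sub>A - F"

abbreviation cover1 :: "'a set \<Rightarrow> 'a set" where
  "cover1 F \<equiv> OPT\<^sub>O \<union> F"

abbreviation cover2 :: "'a set \<Rightarrow> 'a set" where
  "cover2 F \<equiv> result (A (induced G\<^sub>N (rest F)) w) \<union> F"

abbreviation cand :: "'a set \<Rightarrow> ('a set \<times> real) timed" where
  "cand F \<equiv> candidate A vs (edges G\<^sub>N) (verts G\<^sub>A) w OPT\<^sub>O F"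

lemma verts_N: "verts G\<^sub>N = verts G\<^sub>O \<union> verts G\<^sub>A"
  by (simp add: G\<^sub>N insert_graph_def)

lemma simple_N: "simple_graph G\<^sub>N"
  unfolding G\<^sub>N using simple_graph_insert_graph[OF simple_O simple_A disjoint Ea] .

lemma finite_N: "finite (verts G\<^sub>N)"
  using simple_N unfolding simple_graph_def by blast

lemma nonneg: "v \<in> verts G\<^sub>N \<Longrightarrow> 0 \<le> w v"
  using pos unfolding pos_weight_def by force

lemma induced_O: "induced G\<^sub>N (verts G\<^sub>O) = G\<^sub>O"
  unfolding G\<^sub>N using induced_insert_graph[OF simple_O simple_A disjoint Ea] .

lemma rest_subset: "rest F \<subseteq> verts G\<^sub>N"
  by blast

lemma simple_rest: "simple_graph (induced G\<^sub>N (rest F))"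
  using simple_graph_induced[OF simple_N rest_subset] .

lemma pos_rest: "pos_weight (induced G\<^sub>N (rest F)) w"
  using pos unfolding pos_weight_def induced_def by simp

lemma kpvc_rest: "kpvc k (induced G\<^sub>N (rest F)) (result (A (induced G\<^sub>N (rest F)) w))"
  using approx simple_rest pos_rest unfolding approx_alg_def by blast

lemma result_A_subset: "result (A (induced G\<^sub>N (rest F)) w) \<subseteq> rest F"
  using kpvc_rest[of F] unfolding kpvc_def induced_def by simp

lemma OPT\<^sub>O_subset: "OPT\<^sub>O \<subseteq> verts G\<^sub>O"
  using OPT\<^sub>O unfolding min_kpvc_def kpvc_def by blast

lemma kpvc_cover1:
  assumes "F \<subseteq> verts G\<^sub>N"
    and "\<And>p. kpath k G\<^sub>N p \<Longrightarrow> set p \<inter> verts G\<^sub>A \<noteq> {} \<Longrightarrow> set p \<inter> F \<noteq> {}"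
  shows "kpvc k G\<^sub>N (cover1 F)"
proof (rule kpvc_extend)
  show "kpvc k (induced G\<^sub>N (verts G\<^sub>O)) OPT\<^sub>O"
    using OPT\<^sub>O unfolding induced_O min_kpvc_def by blast
  show "set p \<inter> F \<noteq> {}" if p: "kpath k G\<^sub>N p" "\<not> set p \<subseteq> verts G\<^sub>O" for p
  proof (rule assms(2)[OF p(1)])
    have "set p \<subseteq> verts G\<^sub>N"
      using p(1) unfolding kpath_def by blast
    then show "set p \<inter> verts G\<^sub>A \<noteq> {}"
      using p(2) verts_N by blast
  qed
qed (use assms(1) verts_N in auto)

text \<open>A path leaving \<open>rest F\<close> meets \<open>F\<close> or an inserted vertex, and
  in the latter case it meets \<open>F\<close> by the second condition on good families.\<close>

lemma kpvc_cover2: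
  assumes "F \<subseteq> verts G\<^sub>N"
    and "\<And>p. kpath k G\<^sub>N p \<Longrightarrow> set p \<inter> verts G\<^sub>A \<noteq> {} \<Longrightarrow> set p \<inter> F \<noteq> {}"
  shows "kpvc k G\<^sub>N (cover2 F)"
proof (rule kpvc_extend[OF kpvc_rest rest_subset assms(1)])
  fix p assume p: "kpath k G\<^sub>N p" "\<not> set p \<subseteq> rest F"
  then have "set p \<inter> verts G\<^sub>A \<noteq> {} \<or> set p \<inter> F \<noteq> {}"
    unfolding kpath_def by blast
  then show "set p \<inter> F \<noteq> {}"
    using assms(2)[OF p(1)] by blast
qed

lemma weight_cover1:
  assumes "kpvc k G\<^sub>N S" "F \<subseteq> S"
  shows "weight w (cover1 F) \<le> weight w S + weight w F"
proof -
  have S: "S \<subseteq> verts G\<^sub>N"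
    using assms(1) unfolding kpvc_def by blast
  have "kpvc k G\<^sub>O (S \<inter> verts G\<^sub>O)"
    using kpvc_induced[OF assms(1), of "verts G\<^sub>O"] verts_N by (simp add: induced_O)
  then have "weight w OPT\<^sub>O \<le> weight w (S \<inter> verts G\<^sub>O)"
    using OPT\<^sub>O unfolding min_kpvc_def by blast
  also have "\<dots> \<le> weight w S"
    using S finite_subset[OF S finite_N] nonneg by (intro weight_mono) auto
  finally have "weight w OPT\<^sub>O \<le> weight w S" .
  moreover have "OPT\<^sub>O \<union> F \<subseteq> verts G\<^sub>N"
    using OPT\<^sub>O_subset verts_N assms(2) S by blast
  then have "weight w (cover1 F) \<le> weight w OPT\<^sub>O + weight w F"
    using nonneg finite_subset[OF _ finite_N] by (intro weight_Un_le) auto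
  ultimately show ?thesis by linarith
qed

lemma weight_cover2:
  assumes "kpvc k G\<^sub>N S" "F \<subseteq> S"
  shows "weight w (cover2 F) \<le> \<rho> * (weight w S - weight w F) + weight w F"
proof -
  have S: "S \<subseteq> verts G\<^sub>N"
    using assms(1) unfolding kpvc_def by blast
  have fin: "finite S"
    using finite_subset[OF S finite_N] .
  have "weight w (result (A (induced G\<^sub>N (rest F)) w)) \<le> \<rho> * weight w (S \<inter> rest F)"
    using approx \<rho> simple_rest pos_rest kpvc_induced[OF assms(1) rest_subset]
    by (intro approx_alg_le) auto
  \<comment> \<open>Restoring the inserted vertices of \<open>S - F\<close> only adds nonnegative
    weight.\<close>
  also have "\<dots> \<le> \<rho> * weight w (S - F)"
    using \<rho> fin S nonneg by (intro mult_left_mono weight_mono) auto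
  \<comment> \<open>Here \<open>F \<subseteq> S\<close> enters: the weight saved is exactly that of
    \<open>F\<close>.\<close>
  also have "weight w (S - F) = weight w S - weight w F"
    unfolding weight_def using fin assms(2) by (intro sum_diff) auto
  finally have "weight w (result (A (induced G\<^sub>N (rest F)) w))
      \<le> \<rho> * (weight w S - weight w F)" .
  moreover have "cover2 F \<subseteq> verts G\<^sub>N"
    using result_A_subset[of F] assms(2) S by blast
  then have "weight w (cover2 F) \<le> weight w (result (A (induced G\<^sub>N (rest F)) w)) + weight w F"
    using nonneg finite_subset[OF _ finite_N] by (intro weight_Un_le) auto
  ultimately show ?thesis by linarith
qed

section \<open>Result and cost of one candidate\<close>

lemma result_induced_rest:
  "result (induced_op vs (edges G\<^sub>N) (rest F)) = induced G\<^sub>N (rest F)"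
  using result_induced_op[OF simple_N set_vs rest_subset] .

text \<open>The array routines keep only vertices listed in \<open>vs\<close>; as both covers
  consist of such vertices, nothing is lost and the stored weights are the true ones.\<close>

lemma result_candidate:
  assumes "F \<subseteq> verts G\<^sub>N"
  shows "result (cand F) =
    (let S = if weight w (cover1 F) \<le> weight w (cover2 F) then cover1 F else cover2 F
     in (S, weight w S))"
proof -
  have sub: "cover1 F \<subseteq> set vs" "cover2 F \<subseteq> set vs"
    using assms OPT\<^sub>O_subset verts_N set_vs result_A_subset[of F] by blast+
  then have "cover1 F \<inter> set vs = cover1 F" "cover2 F \<inter> set vs = cover2 F"
    by blast+
  moreover have "set vs - verts G\<^sub>A - F = rest F"
    by (simp add: set_vs)
  ultimately show ?thesis
    using result_weight_op[OF distinct sub(1)] result_weight_op[OF distinct sub(2)]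
    by (simp add: candidate_def result_union_op result_rest_op result_induced_rest
        result_lighter_op Let_def)
qed

lemma steps_candidate:
  assumes "running_time A T" "verts G\<^sub>N \<noteq> {}"
  shows "steps (cand F) \<le> 32 * (card (verts G\<^sub>N))\<^sup>2 * T G\<^sub>N w"
proof -
  let ?n = "card (verts G\<^sub>N)" and ?S = "result (A (induced G\<^sub>N (rest F)) w)"
  have n: "length vs = ?n"
    using distinct_card[OF distinct] set_vs by simp
  have "steps (A (induced G\<^sub>N (rest F)) w) \<le> T (induced G\<^sub>N (rest F)) w"
    using assms(1) simple_rest pos_rest unfolding running_time_def by blast
  \<comment> \<open>The run on the subinstance is charged to the whole graph by monotonicity of
    \<open>T\<close> under induced subgraphs.\<close>
  also have "\<dots> \<le> T G\<^sub>N w"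
    using assms(1) simple_N pos rest_subset unfolding running_time_def by blast
  finally have A: "steps (A (induced G\<^sub>N (rest F)) w) \<le> T G\<^sub>N w" .
  have T: "1 \<le> T G\<^sub>N w"
    using assms(1) simple_N pos unfolding running_time_def by blast
  have n1: "1 \<le> ?n"
    using assms(2) finite_N by (simp add: Suc_le_eq card_gt_0_iff)
  then have n2: "?n \<le> ?n\<^sup>2" "1 \<le> ?n\<^sup>2"
    by (simp_all add: power2_eq_square)
  have "set vs - verts G\<^sub>A - F = rest F"
    by (simp add: set_vs)
  then have "steps (cand F) \<le> 5 * ?n + 5 * ?n + (6 * ?n\<^sup>2 + ?n) + T G\<^sub>N w
      + 5 * ?n + 4 * ?n + 4 * ?n + 1"
    using A steps_union_op[of vs OPT\<^sub>O F] steps_rest_op[of vs "verts G\<^sub>A" F]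
      steps_induced_op[of vs "edges G\<^sub>N" "rest F"] steps_union_op[of vs ?S F]
      steps_weight_op[of vs w "(OPT\<^sub>O \<union> F) \<inter> set vs"] steps_weight_op[of vs w "(?S \<union> F) \<inter> set vs"]
    by (simp add: candidate_def result_union_op result_rest_op result_induced_rest
        steps_lighter_op n)
  \<comment> \<open>The routines other than \<open>A\<close> cost
    \<open>6 * ?n\<^sup>2 + 24 * ?n + 1\<close> in total, and 6 + 24 + 1 = 31.\<close>
  also have "\<dots> \<le> 31 * ?n\<^sup>2 + T G\<^sub>N w"
    using n2 by linarith
  also have "\<dots> \<le> 31 * ?n\<^sup>2 * T G\<^sub>N w + ?n\<^sup>2 * T G\<^sub>N w"
    using n2 T by (intro add_mono) simp_all
  finally show ?thesis by (simp add: mult_ac)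
qed

section \<open>Approximation ratio and running time of the algorithm\<close>

theorem construct_sol_correct:
  assumes OPT\<^sub>N: "kpvc k G\<^sub>N OPT\<^sub>N" and good: "good_family k G\<^sub>N (verts G\<^sub>A) OPT\<^sub>N (set Fs)"
  defines "S \<equiv> result (construct_sol A vs (edges G\<^sub>N) (verts G\<^sub>A) w OPT\<^sub>O Fs)"
  shows "kpvc k G\<^sub>N S" "weight w S \<le> (2 - 1 / \<rho>) * weight w OPT\<^sub>N"
proof -
  obtain F\<^sub>0 where F\<^sub>0: "F\<^sub>0 \<in> set Fs" "F\<^sub>0 \<subseteq> OPT\<^sub>N"
    using good unfolding good_family_def by blast
  have sub: "F \<subseteq> verts G\<^sub>N" if "F \<in> set Fs" for F
    using good that unfolding good_family_def by blast
  have "Fs \<noteq> []"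
    using F\<^sub>0(1) by auto
  \<comment> \<open>The selected \<open>F\<close> may differ from \<open>F\<^sub>0\<close> and need
    not lie in \<open>OPT\<^sub>N\<close>. Covering is shown for \<open>F\<close>, the weight bound
    for \<open>F\<^sub>0\<close>, and minimality of the selection links the two.\<close>
  then obtain F where F: "F \<in> set Fs" "S = fst (result (cand F))"
      "\<And>F'. F' \<in> set Fs \<Longrightarrow> snd (result (cand F)) \<le> snd (result (cand F'))"
    using result_construct_sol[of Fs A vs "edges G\<^sub>N" "verts G\<^sub>A" w OPT\<^sub>O] unfolding S_def by metis
  have "set p \<inter> F \<noteq> {}" if "kpath k G\<^sub>N p" "set p \<inter> verts G\<^sub>A \<noteq> {}" for p
    using good F(1) that unfolding good_family_def by blast
  then have "kpvc k G\<^sub>N (cover1 F)" "kpvc k G\<^sub>N (cover2 F)"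
    using kpvc_cover1 kpvc_cover2 sub[OF F(1)] by blast+
  then show "kpvc k G\<^sub>N S"
    unfolding F(2) result_candidate[OF sub[OF F(1)]] by (simp add: Let_def)
  have "weight w S = snd (result (cand F))"
    unfolding F(2) result_candidate[OF sub[OF F(1)]] by (simp add: Let_def)
  also have "\<dots> \<le> snd (result (cand F\<^sub>0))"
    using F(3)[OF F\<^sub>0(1)] .
  also have "\<dots> = min (weight w (cover1 F\<^sub>0)) (weight w (cover2 F\<^sub>0))"
    unfolding result_candidate[OF sub[OF F\<^sub>0(1)]] by (simp add: Let_def min_def)
  also have "\<dots> \<le> (2 - 1 / \<rho>) * weight w OPT\<^sub>N"
    using min_le_convex_combination[OF \<rho> weight_cover1[OF OPT\<^sub>N F\<^sub>0(2)]
        weight_cover2[OF OPT\<^sub>N F\<^sub>0(2)]] .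
  finally show "weight w S \<le> (2 - 1 / \<rho>) * weight w OPT\<^sub>N" .
qed

text \<open>An empty graph is excluded because the bound would be 0 there, while each candidate
  still performs a comparison.\<close>

theorem construct_sol_steps:
  assumes "running_time A T" "verts G\<^sub>N \<noteq> {}"
  shows "steps (construct_sol A vs (edges G\<^sub>N) (verts G\<^sub>A) w OPT\<^sub>O Fs)
    \<le> 34 * (card (verts G\<^sub>N))\<^sup>2 * length Fs * T G\<^sub>N w"
proof -
  let ?c = "(card (verts G\<^sub>N))\<^sup>2 * T G\<^sub>N w"
  have "0 < card (verts G\<^sub>N)"
    using assms(2) finite_N by (simp add: card_gt_0_iff)
  moreover have "1 \<le> T G\<^sub>N w"
    using assms(1) simple_N pos unfolding running_time_def by blast
  ultimately have "1 \<le> ?c"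
    by (simp add: Suc_le_eq)
  have "steps (construct_sol A vs (edges G\<^sub>N) (verts G\<^sub>A) w OPT\<^sub>O Fs) \<le> length Fs * (32 * ?c + 2)"
    using steps_candidate[OF assms] by (intro steps_construct_sol_le) (simp add: mult.assoc)
  \<comment> \<open>Since \<open>?c\<close> is at least 1, the additive 2 is absorbed: 32 + 2 =
    34.\<close>
  also have "\<dots> \<le> length Fs * (34 * ?c)"
    using \<open>1 \<le> ?c\<close> by (intro mult_left_mono) linarith+
  finally show ?thesis
    by (simp add: mult_ac)
qed

end

text \<open>The constant \<open>C\<close> is chosen before the graphs, weights, family and
  algorithm, so the O-bound is uniform in all of them. The family is a list because the algorithm
  processes its members in order; its length is the number \<psi>.\<close>

theorem theorem2:
  fixes k :: nat
  assumes "k \<ge> 2"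
  shows "\<exists>C :: nat.
    \<forall>(\<rho> :: real) (A :: 'a cover_alg) (G\<^sub>O :: 'a ugraph) (G\<^sub>A :: 'a ugraph) (Ea :: ('a \<times> 'a) set)
      (G\<^sub>N :: 'a ugraph) (w :: 'a \<Rightarrow> real) (OPT\<^sub>O :: 'a set) (OPT\<^sub>N :: 'a set)
      (Fs :: 'a set list) (vs :: 'a list) (ALG :: 'a set timed).
      simple_graph G\<^sub>O \<and> simple_graph G\<^sub>A \<and> verts G\<^sub>O \<inter> verts G\<^sub>A = {} \<and>
      Ea \<subseteq> verts G\<^sub>O \<times> verts G\<^sub>A \<and> G\<^sub>N = insert_graph G\<^sub>O G\<^sub>A Ea \<and>
      pos_weight G\<^sub>N w \<and>
      min_kpvc k G\<^sub>O w OPT\<^sub>O \<and> min_kpvc k G\<^sub>N w OPT\<^sub>N \<and>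
      \<rho> \<ge> 1 \<and> approx_alg k \<rho> A \<and>
      good_family k G\<^sub>N (verts G\<^sub>A) OPT\<^sub>N (set Fs) \<and>
      distinct vs \<and> set vs = verts G\<^sub>N \<and>
      ALG = construct_sol A vs (edges G\<^sub>N) (verts G\<^sub>A) w OPT\<^sub>O Fs
      \<longrightarrow>
      kpvc k G\<^sub>N (result ALG) \<and>
      weight w (result ALG) \<le> (2 - 1 / \<rho>) * weight w OPT\<^sub>N \<and>
      (verts G\<^sub>N \<noteq> {} \<longrightarrow> (\<forall>T. running_time A T \<longrightarrow>
         steps ALG \<le> C * (card (verts G\<^sub>N))\<^sup>2 * length Fs * T G\<^sub>N w))"
proof (intro exI[of _ 34] allI impI)
  fix \<rho> :: real and A :: "'a cover_alg" and G\<^sub>O G\<^sub>A :: "'a ugraph" and Ea :: "('a \<times> 'a) set"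
    and G\<^sub>N :: "'a ugraph" and w :: "'a \<Rightarrow> real" and OPT\<^sub>O OPT\<^sub>N :: "'a set"
    and Fs :: "'a set list" and vs :: "'a list" and ALG :: "'a set timed"
  assume *: "simple_graph G\<^sub>O \<and> simple_graph G\<^sub>A \<and> verts G\<^sub>O \<inter> verts G\<^sub>A = {} \<and>
      Ea \<subseteq> verts G\<^sub>O \<times> verts G\<^sub>A \<and> G\<^sub>N = insert_graph G\<^sub>O G\<^sub>A Ea \<and>
      pos_weight G\<^sub>N w \<and>
      min_kpvc k G\<^sub>O w OPT\<^sub>O \<and> min_kpvc k G\<^sub>N w OPT\<^sub>N \<and>
      \<rho> \<ge> 1 \<and> approx_alg k \<rho> A \<and>
      good_family k G\<^sub>N (verts G\<^sub>A) OPT\<^sub>N (set Fs) \<and>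
      distinct vs \<and> set vs = verts G\<^sub>N \<and>
      ALG = construct_sol A vs (edges G\<^sub>N) (verts G\<^sub>A) w OPT\<^sub>O Fs"
  then interpret inserted_graph k \<rho> A G\<^sub>O G\<^sub>A G\<^sub>N Ea w OPT\<^sub>O vs
    by unfold_locales blast+
  have "kpvc k G\<^sub>N OPT\<^sub>N"
    using * unfolding min_kpvc_def by blast
  then show "kpvc k G\<^sub>N (result ALG) \<and>
      weight w (result ALG) \<le> (2 - 1 / \<rho>) * weight w OPT\<^sub>N \<and>
      (verts G\<^sub>N \<noteq> {} \<longrightarrow> (\<forall>T. running_time A T \<longrightarrow>
         steps ALG \<le> 34 * (card (verts G\<^sub>N))\<^sup>2 * length Fs * T G\<^sub>N w))"
    using * construct_sol_correct construct_sol_steps by blast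
qed

end
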